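(* Let $S$ be a finite group, $p$ a prime, and $A$ a normal subgroup of $S$ of index $p$. Let $\mathcal{B}$ be the set of subgroups of $A$, and $\mathcal{R}$ the set of subgroups of $S$ not contained in $A$. For $H \in \mathcal{B}$, let $T_{H} \subseteq S$ (with $T_H \subseteq N_S(H)$) be such that $\{ H\langle t \rangle : t \in T_{H} \}$, regarded as the set of subgroups $H\langle t\rangle/H$ of $N_S(H)/H$, is a transversal of the conjugacy classes (under $N_S(H)/H$) of those subgroups of order $p$ of $N_{S}(H)/H$ which are not contained in $N_{A}(H)/H$. Then the set \[ \coprod_{[H]_{A} \in \mathcal{B}/A} \{ \langle H, t \rangle : t \in T_{H} \}, \] where $H$ ranges over a transversal of $\mathcal{B}/A$, is a transversal of $\mathcal{R}/S$.
   Context: $\mathcal{B}/A$ is the set of $A$-conjugacy classes $[H]_A$ of subgroups of $A$; $\mathcal{R}/S$ is the set of $S$-conjugacy classes of subgroups in $\mathcal{R}$. A transversal of a set of classes is a set containing exactly one element of each class. $\coprod$ denotes disjoint union. *)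

theory Defs
  imports "HOL-Algebra.Algebra" "HOL-Library.Disjoint_Sets"
begin

definition conj_classes :: "('a, 'b) monoid_scheme \<Rightarrow> 'a set \<Rightarrow> 'a set set \<Rightarrow> 'a set set set" where
  "conj_classes G K \<D> =
     orbits (G\<lparr>carrier := K\<rparr>) \<D> (\<lambda>g H. g <#\<^bsub>G\<^esub> H #>\<^bsub>G\<^esub> (inv\<^bsub>G\<^esub> g))"

definition is_transversal :: "'x set \<Rightarrow> 'x set set \<Rightarrow> bool" where
  "is_transversal D \<C> \<longleftrightarrow> D \<subseteq> \<Union>\<C> \<and> (\<forall>c\<in>\<C>. \<exists>!x. x \<in> D \<inter> c)"

text \<open>For \<open>H\<close> normal in \<open>K \<le> N\<^sub>G(H)\<close>, the subgroup \<open>K/H\<close> of \<open>N\<^sub>G(H)/H\<close>, as a set of cosets.\<close>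
definition quot_subgroup :: "('a, 'b) monoid_scheme \<Rightarrow> 'a set \<Rightarrow> 'a set \<Rightarrow> 'a set set" where
  "quot_subgroup G K H = carrier ((G\<lparr>carrier := K\<rparr>) Mod H)"

definition normalizer_quot :: "('a, 'b) monoid_scheme \<Rightarrow> 'a set \<Rightarrow> 'a set monoid" where
  "normalizer_quot G H = (G\<lparr>carrier := normalizer G H\<rparr>) Mod H"

text \<open>The normaliser \<open>N\<^sub>A(H)\<close> is computed in the group \<open>A\<close>.\<close>
definition outer_subgroups ::
  "('a, 'b) monoid_scheme \<Rightarrow> 'a set \<Rightarrow> nat \<Rightarrow> 'a set \<Rightarrow> 'a set set set" where
  "outer_subgroups S A p H =
     {K. subgroup K (normalizer_quot S H) \<and> card K = p \<and>
         \<not> K \<subseteq> quot_subgroup S (normalizer (S\<lparr>carrier := A\<rparr>) H) H}"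

text \<open>The condition on the set \<open>T\<^sub>H\<close>. It concerns only the set of subgroups \<open>H\<langle>t\<rangle>/H\<close>, so different
  elements of \<open>T\<^sub>H\<close> may give the same subgroup. As \<open>t\<close> normalises \<open>H\<close>, the product set of \<open>H\<close>
  and \<open>\<langle>t\<rangle>\<close> is a subgroup.\<close>
definition transversal_generators ::
  "('a, 'b) monoid_scheme \<Rightarrow> 'a set \<Rightarrow> nat \<Rightarrow> 'a set \<Rightarrow> 'a set \<Rightarrow> bool" where
  "transversal_generators S A p H T \<longleftrightarrow>
     T \<subseteq> normalizer S H \<and>
     is_transversal
       ((\<lambda>t. quot_subgroup S (H <#>\<^bsub>S\<^esub> generate S {t}) H) ` T)
       (conj_classes (normalizer_quot S H) (carrier (normalizer_quot S H))
          (outer_subgroups S A p H))"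

end

theory Submission
  imports Defs
begin

text \<open>Since \<open>A\<close> has prime index, a subgroup \<open>R\<close> not contained in \<open>A\<close> satisfies \<open>S = A R\<close>, so that \<open>R\<close>
  contains \<open>R \<inter> A\<close> as a normal subgroup of index \<open>p\<close>. Hence \<open>K \<mapsto> K/H\<close> identifies the subgroups with
  \<open>K \<inter> A = H\<close> and \<open>K \<notin> \<B>\<close> with the subgroups of order \<open>p\<close> of \<open>N\<^sub>S(H)/H\<close> outside \<open>N\<^sub>A(H)/H\<close>,
  compatibly with conjugation. The map \<open>R \<mapsto> R \<inter> A\<close> is equivariant, and as \<open>S = A R\<close> the \<open>S\<close>-class
  of \<open>R\<close> is its \<open>A\<close>-class; so each class in \<open>\<R>/S\<close> lies over a single class in \<open>\<B>/A\<close>, and the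
  classes over \<open>[H]\<^sub>A\<close> are the \<open>N\<^sub>S(H)\<close>-classes of subgroups \<open>K\<close> with \<open>K \<inter> A = H\<close>.\<close>

section \<open>Conjugate subsets and transversals of conjugacy classes\<close>

abbreviation conj_by :: "('a, 'b) monoid_scheme \<Rightarrow> 'a \<Rightarrow> 'a set \<Rightarrow> 'a set" where
  "conj_by G g H \<equiv> g <#\<^bsub>G\<^esub> H #>\<^bsub>G\<^esub> (inv\<^bsub>G\<^esub> g)"

lemma conj_by_image: "conj_by G g H = (\<lambda>h. g \<otimes>\<^bsub>G\<^esub> h \<otimes>\<^bsub>G\<^esub> inv\<^bsub>G\<^esub> g) ` H"
  by (auto simp: l_coset_def r_coset_def)

lemma conj_classes_image: "conj_classes G K \<D> = (\<lambda>R. (\<lambda>g. conj_by G g R) ` K) ` \<D>"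
  by (auto simp: conj_classes_def orbits_def orbit_def)

text \<open>Each class is the orbit of some \<open>L \<in> \<D>\<close>, so conditions on classes
  become conditions on representatives. The later arguments then never handle the classes
  themselves.\<close>

lemma is_transversal_conj_classes_iff:
  "is_transversal D (conj_classes G K \<D>) \<longleftrightarrow>
    (\<forall>R\<in>D. \<exists>L\<in>\<D>. \<exists>g\<in>K. R = conj_by G g L) \<and>
    (\<forall>L\<in>\<D>. \<exists>!R. R \<in> D \<and> (\<exists>g\<in>K. R = conj_by G g L))"
proof -
  have "D \<subseteq> \<Union>(conj_classes G K \<D>) \<longleftrightarrow> (\<forall>R\<in>D. \<exists>L\<in>\<D>. \<exists>g\<in>K. R = conj_by G g L)"
    unfolding conj_classes_image by (simp add: subset_iff image_iff Ball_def)
  moreover have "(\<forall>c\<in>conj_classes G K \<D>. \<exists>!R. R \<in> D \<inter> c)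
      \<longleftrightarrow> (\<forall>L\<in>\<D>. \<exists>!R. R \<in> D \<and> (\<exists>g\<in>K. R = conj_by G g L))"
    unfolding conj_classes_image by (simp add: image_iff)
  ultimately show ?thesis unfolding is_transversal_def by (rule conj_cong)
qed

text \<open>An injective \<open>f\<close> commutes with the intersections
  \<open>D \<inter> c\<close>, so unique existence is reflected from the images. This lifts a
  transversal from a quotient group, with \<open>f\<close> sending \<open>K\<close> to
  \<open>K/H\<close>. Injectivity covers \<open>D\<close> as well, because
  \<open>D \<subseteq> \<Union>\<C>\<close> is part of the conclusion.\<close>

lemma is_transversal_image_inj:
  assumes "is_transversal (f ` D) ((`) f ` \<C>)" and "inj_on f (D \<union> \<Union>\<C>)"
  shows "is_transversal D \<C>"
  unfolding is_transversal_def
proof (intro conjI ballI)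
  have sub: "f ` D \<subseteq> f ` \<Union>\<C>"
    using assms(1) by (simp add: is_transversal_def image_Union image_image)
  show "D \<subseteq> \<Union>\<C>"
  proof
    fix x assume "x \<in> D"
    then obtain y where "y \<in> \<Union>\<C>" "f x = f y" using sub by blast
    then show "x \<in> \<Union>\<C>" using assms(2) \<open>x \<in> D\<close> by (metis UnCI inj_onD)
  qed
  fix c assume c: "c \<in> \<C>"
  then have ex: "\<exists>!y. y \<in> f ` D \<inter> f ` c"
    using assms(1) by (auto simp: is_transversal_def)
  have "f ` D \<inter> f ` c = f ` (D \<inter> c)"
    using assms(2) c by (intro inj_on_image_Int[symmetric, of f "D \<union> \<Union>\<C>"]) auto
  moreover have "inj_on f (D \<inter> c)" by (rule inj_on_subset[OF assms(2)]) auto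
  ultimately show "\<exists>!x. x \<in> D \<inter> c"
    using ex unfolding inj_on_def by (metis imageE imageI)
qed

section \<open>Conjugation, normalisers and subgroups of prime order\<close>

context group
begin

lemma conj_by_mult:
  assumes "g \<in> carrier G" "h \<in> carrier G" "H \<subseteq> carrier G"
  shows "conj_by G g (conj_by G h H) = conj_by G (g \<otimes> h) H"
  unfolding conj_by_image image_image
  by (rule image_cong) (use assms in \<open>auto simp: subset_iff m_assoc inv_mult_group\<close>)

lemma conj_by_one: "H \<subseteq> carrier G \<Longrightarrow> conj_by G \<one> H = H"
  unfolding conj_by_image by (force simp: subset_iff image_iff)

lemma conj_by_inv:
  assumes "g \<in> carrier G" "H \<subseteq> carrier G"
  shows "conj_by G (inv g) (conj_by G g H) = H"
  using assms conj_by_mult[of "inv g" g H] conj_by_one[of H] by (simp del: inv_inv)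

lemma conj_by_Int:
  assumes "g \<in> carrier G" "H \<subseteq> carrier G" "K \<subseteq> carrier G"
  shows "conj_by G g (H \<inter> K) = conj_by G g H \<inter> conj_by G g K"
proof -
  have "inj_on (\<lambda>h. g \<otimes> h \<otimes> inv g) (carrier G)" using assms by (auto simp: inj_on_def)
  then show ?thesis unfolding conj_by_image using assms by (intro inj_on_image_Int)
qed

lemma subgroup_conj_by:
  assumes "g \<in> carrier G" "subgroup H G"
  shows "subgroup (conj_by G g H) G"
proof -
  have "(g \<otimes> x \<otimes> inv g) \<otimes> (g \<otimes> y \<otimes> inv g) = g \<otimes> (x \<otimes> y) \<otimes> inv g"
    if "x \<in> carrier G" "y \<in> carrier G" for x y
    using assms(1) that by (simp add: m_assoc) (simp add: flip: m_assoc)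
  then have "group_hom G G (\<lambda>h. g \<otimes> h \<otimes> inv g)"
    using assms(1) by (intro group_hom.intro group_hom_axioms.intro homI is_group) simp_all
  then show ?thesis unfolding conj_by_image
    using assms(2) group_hom.subgroup_img_is_subgroup by blast
qed

lemma conj_by_normal:
  assumes "A \<lhd> G" "g \<in> carrier G"
  shows "conj_by G g A = A"
proof -
  have A: "A \<subseteq> carrier G" using assms(1) normal_imp_subgroup subgroup.subset by blast
  have "g <# A = A #> g" using assms normal.coset_eq by metis
  then show ?thesis using assms(2) A by (simp add: coset_mult_assoc)
qed

lemma conj_by_subgroup: "subgroup K G \<Longrightarrow> g \<in> K \<Longrightarrow> conj_by G g K = K"
  by (metis coset_join2 coset_join3 subgroup.m_inv_closed subgroup.mem_carrier)

lemma mem_normalizer_iff: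
  assumes "H \<subseteq> carrier G"
  shows "g \<in> normalizer G H \<longleftrightarrow> g \<in> carrier G \<and> conj_by G g H = H"
  using assms by (simp add: normalizer_def stabilizer_def)

text \<open>Conjugation by an element of \<open>A\<close> is the same operation in \<open>A\<close>
  and in \<open>G\<close>, since inverses agree. This rewrites the normaliser taken in
  \<open>A\<close> that occurs in \<open>outer_subgroups\<close>.\<close>

lemma normalizer_subgroup_eq:
  assumes "subgroup A G" "H \<subseteq> A"
  shows "normalizer (G\<lparr>carrier := A\<rparr>) H = normalizer G H \<inter> A"
proof -
  have "H \<subseteq> carrier G" using assms subgroup.subset by blast
  then show ?thesis using assms subgroup.mem_carrier[OF assms(1)]
    by (auto simp: mem_normalizer_iff) (auto simp: normalizer_def stabilizer_def)
qed

text \<open>This makes \<open>Union\<close> a left inverse of \<open>K \<mapsto> K/H\<close> on the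
  subgroups containing \<open>H\<close>, which later yields injectivity.\<close>

lemma Union_rcosets_image:
  assumes "subgroup H G" "subgroup K G" "H \<subseteq> K"
  shows "\<Union>((#>) H ` K) = K"
proof
  show "\<Union>((#>) H ` K) \<subseteq> K"
    using assms subgroup.m_closed by (fastforce simp: r_coset_def)
  show "K \<subseteq> \<Union>((#>) H ` K)"
    using assms by (auto intro!: rcos_self subgroup.mem_carrier)
qed

lemma subgroup_of_prime_order:
  assumes "subgroup L G" "subgroup Y G" "Y \<subseteq> L" "Factorial_Ring.prime (card L)"
  shows "Y = {\<one>} \<or> Y = L"
proof -
  \<comment> \<open>An infinite set has \<open>card\<close> 0, which is not prime. Finiteness turns
    equal cardinalities into equal sets below.\<close>
  have fin: "finite L" using assms(4) by (metis card.infinite not_prime_0)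
  interpret L: group "G\<lparr>carrier := L\<rparr>" using assms(1) by (rule subgroup_imp_group)
  have "subgroup Y (G\<lparr>carrier := L\<rparr>)" using assms by (intro subgroup_incl)
  then have "card Y dvd card L"
    using L.lagrange[of Y] by (simp add: order_def) (metis dvd_triv_right)
  then have "card Y = 1 \<or> card Y = card L" using assms(4) by (simp add: prime_nat_iff)
  then show ?thesis
  proof
    assume "card Y = 1"
    then show ?thesis using subgroup.one_closed[OF assms(2)] by (auto simp: card_1_singleton_iff)
  next
    assume "card Y = card L"
    then show ?thesis using card_subset_eq fin assms(3) by blast
  qed
qed

end

section \<open>Subgroups and conjugation in a quotient group\<close>

context normal
begin

lemma mult_Mod:
  "a \<in> carrier G \<Longrightarrow> b \<in> carrier G \<Longrightarrow> (H #> a) \<otimes>\<^bsub>G Mod H\<^esub> (H #> b) = H #> (a \<otimes> b)"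
  by (simp add: rcos_sum)

lemma inv_Mod: "a \<in> carrier G \<Longrightarrow> inv\<^bsub>G Mod H\<^esub> (H #> a) = H #> (inv a)"
  by (simp add: inv_FactGroup carrier_FactGroup rcos_inv)

lemma subgroup_rcosets_image:
  assumes "subgroup K G"
  shows "subgroup ((#>) H ` K) (G Mod H)"
proof -
  have "group_hom G (G Mod H) ((#>) H)"
    by (intro group_hom.intro group_hom_axioms.intro r_coset_hom_Mod factorgroup_is_group is_group)
  then show ?thesis using assms group_hom.subgroup_img_is_subgroup by blast
qed

text \<open>Cosets are the fibres of the projection, so \<open>\<Union>Q\<close> is the preimage of
  \<open>Q\<close>. This is the half of the correspondence theorem that goes from the quotient back
  to the group.\<close>

lemma subgroup_Mod_Union:
  assumes Q: "subgroup Q (G Mod H)"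
  shows "subgroup (\<Union>Q) G" "H \<subseteq> \<Union>Q" "(#>) H ` \<Union>Q = Q"
proof -
  have mem_iff: "\<Union>Q = {a \<in> carrier G. H #> a \<in> Q}"
  proof -
    have "Y = H #> a" "a \<in> carrier G" if "a \<in> Y" "Y \<in> Q" for a Y
    proof -
      have "Y \<in> rcosets H" using that Q subgroup.subset by (fastforce simp: FactGroup_def)
      then obtain b where "b \<in> carrier G" "Y = H #> b" by (auto simp: RCOSETS_def)
      then show "Y = H #> a" "a \<in> carrier G"
        using that repr_independence elemrcos_carrier is_group is_subgroup by blast+
    qed
    then show ?thesis using rcos_self is_subgroup by fast
  qed
  have H_mem: "H \<in> Q" using subgroup.one_closed[OF Q] by simp
  then show "H \<subseteq> \<Union>Q" by auto
  show "subgroup (\<Union>Q) G"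
  proof (rule subgroupI)
    show "\<Union>Q \<noteq> {}" using H_mem subgroup.one_closed[OF is_subgroup] by (metis UnionI empty_iff)
    show "\<Union>Q \<subseteq> carrier G" unfolding mem_iff by blast
    show "inv a \<in> \<Union>Q" if "a \<in> \<Union>Q" for a
      using that subgroup.m_inv_closed[OF Q] unfolding mem_iff by (auto simp: inv_Mod[symmetric])
    show "a \<otimes> b \<in> \<Union>Q" if "a \<in> \<Union>Q" "b \<in> \<Union>Q" for a b
      using that subgroup.m_closed[OF Q, of "H #> a" "H #> b"] mult_Mod[of a b]
      unfolding mem_iff by simp
  qed
  have "Q \<subseteq> (#>) H ` carrier G" using subgroup.subset[OF Q] by (simp add: carrier_FactGroup)
  then show "(#>) H ` \<Union>Q = Q" unfolding mem_iff by auto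
qed

lemma conj_by_Mod:
  assumes "g \<in> carrier G" "K \<subseteq> carrier G"
  shows "conj_by (G Mod H) (H #> g) ((#>) H ` K) = (#>) H ` conj_by G g K"
  unfolding conj_by_image image_image
proof (rule image_cong[OF refl])
  fix x assume "x \<in> K"
  then have "x \<in> carrier G" using assms by auto
  with assms show "(H #> g) \<otimes>\<^bsub>G Mod H\<^esub> (H #> x) \<otimes>\<^bsub>G Mod H\<^esub> inv\<^bsub>G Mod H\<^esub> (H #> g) = H #> (g \<otimes> x \<otimes> inv g)"
    by (simp add: mult_Mod inv_Mod del: mult_FactGroup)
qed

text \<open>Every element of the quotient has the form \<open>H #> g\<close>, and the projection
  respects conjugation. The nested images apply the projection to elements, then to subgroups, then
  to classes.\<close>

lemma conj_classes_Mod: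
  assumes "\<And>K. K \<in> \<D> \<Longrightarrow> K \<subseteq> carrier G"
  shows "conj_classes (G Mod H) (carrier (G Mod H)) ((`) ((#>) H) ` \<D>)
    = (`) ((`) ((#>) H)) ` conj_classes G (carrier G) \<D>"
  unfolding conj_classes_image image_image carrier_FactGroup
  by (intro image_cong refl conj_by_Mod assms)

end

lemma quot_subgroup_eq: "quot_subgroup G K H = (#>\<^bsub>G\<^esub>) H ` K"
  by (simp add: quot_subgroup_def carrier_FactGroup)

text \<open>Two maps with the same fibres on \<open>K\<close> have images in bijection. It allows
  the indices of two subgroups to be compared without constructing an isomorphism of
  quotients.\<close>

lemma card_image_eq_if_same_kernel:
  assumes "\<And>x y. x \<in> K \<Longrightarrow> y \<in> K \<Longrightarrow> f x = f y \<longleftrightarrow> g x = g y"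
  shows "card (f ` K) = card (g ` K)"
proof -
  \<comment> \<open>The choice of preimage made by \<open>inv_into\<close> is harmless, as
    \<open>g\<close> is constant on the fibres of \<open>f\<close> in \<open>K\<close>.\<close>
  define h where "h = (\<lambda>z. g (inv_into K f z))"
  have h: "h (f x) = g x" if "x \<in> K" for x
    unfolding h_def using assms that by (metis f_inv_into_f imageI inv_into_into)
  then have "inj_on h (f ` K)" using assms by (auto simp: inj_on_def)
  moreover have "h ` f ` K = g ` K" using h by (auto simp: image_iff)
  ultimately show ?thesis by (metis card_image)
qed

context group
begin

text \<open>The product set is a subgroup because \<open>t\<close> normalises \<open>H\<close>, and
  minimality of \<open>generate\<close> does the rest. It links the product in
  \<open>transversal_generators\<close> to the subgroup generated by \<open>H\<close> and
  \<open>t\<close>.\<close>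

lemma generate_insert_normalizer:
  assumes H: "subgroup H G" and t: "t \<in> normalizer G H"
  shows "H <#> generate G {t} = generate G (insert t H)"
proof
  let ?N = "normalizer G H" and ?C = "generate G {t}"
  have N: "subgroup ?N G" by (rule normalizer_imp_subgroup[OF subgroup.subset[OF H]])
  interpret N: group "G\<lparr>carrier := ?N\<rparr>" using N by (rule subgroup_imp_group)
  have tG: "t \<in> carrier G" using N t by (rule subgroup.mem_carrier)
  have C: "subgroup ?C G" using tG by (simp add: generate_is_subgroup)
  have "?C \<subseteq> ?N" using t N by (intro generate_subgroup_incl) auto
  \<comment> \<open>Inside its normaliser \<open>H\<close> is normal, so its product with any
    subgroup there is a subgroup.\<close>
  then have "subgroup (H <#>\<^bsub>G\<lparr>carrier := ?N\<rparr>\<^esub> ?C) (G\<lparr>carrier := ?N\<rparr>)"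
    by (intro N.mult_norm_subgroup subgroup_in_normalizer H subgroup_incl C N)
  then have HC: "subgroup (H <#> ?C) G"
    using incl_subgroup[OF N] by (simp add: set_mult_def)
  have "t = \<one> \<otimes> t" using tG by simp
  then have "t \<in> H <#> ?C"
    unfolding set_mult_def using subgroup.one_closed[OF H] generate.incl[of t "{t}" G] by blast
  moreover have "h \<in> H <#> ?C" if "h \<in> H" for h
  proof -
    have "h = h \<otimes> \<one>" using subgroup.mem_carrier[OF H that] by simp
    then show ?thesis unfolding set_mult_def using that generate.one[of G "{t}"] by blast
  qed
  ultimately show "generate G (insert t H) \<subseteq> H <#> ?C"
    by (intro generate_subgroup_incl HC) blast
  have "?C \<subseteq> generate G (insert t H)" by (rule mono_generate) simp
  then show "H <#> ?C \<subseteq> generate G (insert t H)"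
    by (auto simp: set_mult_def intro!: generate.eng intro: generate.incl)
qed

text \<open>In the conjugation action only the inverse depends on the carrier, and a subgroup has
  the same inverses.\<close>

lemma conj_classes_subgroup:
  assumes "subgroup K G"
  shows "conj_classes (G\<lparr>carrier := K\<rparr>) K \<D> = conj_classes G K \<D>"
  unfolding conj_classes_image by (intro image_cong refl) (simp add: assms)

section \<open>Normal subgroups of prime index\<close>

context
  fixes A and p :: nat
  assumes A: "A \<lhd> G" and p: "Factorial_Ring.prime p" and index: "card (rcosets A) = p"
begin

interpretation A: normal A G by (rule A)

text \<open>The image of \<open>K\<close> is a subgroup of \<open>G Mod A\<close>, a group of prime
  order, and it is nontrivial because \<open>K\<close> has an element outside \<open>A\<close>. In
  coset form this says \<open>G = A K\<close>.\<close>

lemma rcosets_image_prime_index: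
  assumes "subgroup K G" "\<not> K \<subseteq> A"
  shows "(#>) A ` K = rcosets A"
proof -
  interpret Q: group "G Mod A" by (rule A.factorgroup_is_group)
  have c: "carrier (G Mod A) = rcosets A" by (simp add: FactGroup_def)
  obtain k where k: "k \<in> K" "k \<notin> A" using assms(2) by blast
  have "(#>) A ` K = {A} \<or> (#>) A ` K = rcosets A"
    using Q.subgroup_of_prime_order[OF Q.subgroup_self A.subgroup_rcosets_image[OF assms(1)]]
      subgroup.subset[OF A.subgroup_rcosets_image[OF assms(1)]] p index
    by (simp add: c)
  moreover have "A #> k \<noteq> A"
    using k coset_join1[OF _ subgroup.mem_carrier[OF assms(1) k(1)] A.is_subgroup] by auto
  ultimately show ?thesis using k by blast
qed

lemma factor_prime_index:
  assumes "subgroup K G" "\<not> K \<subseteq> A" "g \<in> carrier G"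
  obtains a k where "a \<in> A" "k \<in> K" "g = a \<otimes> k"
proof -
  have "A #> g \<in> (#>) A ` K"
    unfolding rcosets_image_prime_index[OF assms(1,2)] using assms(3) A.subset by (rule rcosetsI[rotated])
  then obtain k where "k \<in> K" "A #> g = A #> k" by blast
  then have "g \<in> A #> k" using rcos_self[OF assms(3) A.is_subgroup] by simp
  then show thesis using that \<open>k \<in> K\<close> by (auto simp: r_coset_def)
qed

text \<open>For \<open>x\<close> and \<open>y\<close> in \<open>K\<close>, the element
  \<open>x \<otimes> inv y\<close> lies in \<open>K\<close> anyway, so cosets of
  \<open>K \<inter> A\<close> and of \<open>A\<close> agree or differ together. This is the second
  isomorphism theorem for \<open>G = A K\<close>, at the level of cardinalities.\<close>

lemma card_rcosets_image_Int:
  assumes "subgroup K G" "\<not> K \<subseteq> A"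
  shows "card ((#>) (K \<inter> A) ` K) = p"
proof -
  have KA: "subgroup (K \<inter> A) G" using assms(1) A.is_subgroup by (rule subgroups_Inter_pair)
  have eq: "L #> x = L #> y \<longleftrightarrow> x \<otimes> inv y \<in> L"
    if "subgroup L G" "x \<in> carrier G" "y \<in> carrier G" for L x y
  proof
    have L: "L \<subseteq> carrier G" using that(1) by (rule subgroup.subset)
    show "x \<otimes> inv y \<in> L" if "L #> x = L #> y"
      by (rule coset_join1[OF coset_mult_inv2[OF that]]) (use \<open>subgroup L G\<close> L \<open>x \<in> _\<close> \<open>y \<in> _\<close> in simp_all)
    show "L #> x = L #> y" if "x \<otimes> inv y \<in> L"
      by (rule coset_mult_inv1[OF coset_join2[OF _ _ that]]) (use \<open>subgroup L G\<close> L \<open>x \<in> _\<close> \<open>y \<in> _\<close> in simp_all)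
  qed
  have "card ((#>) (K \<inter> A) ` K) = card ((#>) A ` K)"
  proof (rule card_image_eq_if_same_kernel)
    fix x y assume "x \<in> K" "y \<in> K"
    then show "(K \<inter> A) #> x = (K \<inter> A) #> y \<longleftrightarrow> A #> x = A #> y"
      using assms(1) subgroup.mem_carrier[OF assms(1)] subgroup.m_closed[OF assms(1)]
        subgroup.m_inv_closed[OF assms(1)] by (simp add: eq KA A.is_subgroup)
  qed
  then show ?thesis using rcosets_image_prime_index[OF assms] index by simp
qed

section \<open>Subgroups meeting \<open>A\<close> in \<open>H\<close>, seen in the quotient by
  \<open>H\<close>\<close>

lemma subset_normalizer_Int:
  assumes "subgroup K G"
  shows "K \<subseteq> normalizer G (K \<inter> A)"
proof
  fix k assume "k \<in> K"
  with assms have k: "k \<in> carrier G" by (rule subgroup.mem_carrier)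
  \<comment> \<open>Conjugation by \<open>k\<close> preserves \<open>K\<close> because
    \<open>k \<in> K\<close>, and \<open>A\<close> because \<open>A\<close> is normal.\<close>
  then have "conj_by G k (K \<inter> A) = K \<inter> A"
    using \<open>k \<in> K\<close> assms A by (simp add: conj_by_Int conj_by_subgroup conj_by_normal subgroup.subset A.subset)
  then show "k \<in> normalizer G (K \<inter> A)"
    using k A.subset by (subst mem_normalizer_iff) auto
qed

text \<open>The correspondence is \<open>K \<mapsto> K/H\<close>. Order \<open>p\<close> and not
  lying in \<open>N_A(H)/H\<close> together translate to \<open>K \<inter> A = H\<close> with
  \<open>K\<close> not inside \<open>A\<close>.\<close>

lemma outer_subgroups_eq:
  assumes H: "subgroup H G" "H \<subseteq> A"
  shows "outer_subgroups G A p H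
    = (`) ((#>) H) ` {K. subgroup K G \<and> \<not> K \<subseteq> A \<and> K \<inter> A = H}"
proof -
  define N where "N = normalizer G H"
  have N: "subgroup N G" unfolding N_def by (rule normalizer_imp_subgroup[OF subgroup.subset[OF H(1)]])
  interpret N: normal H "G\<lparr>carrier := N\<rparr>" unfolding N_def using H(1) by (rule subgroup_in_normalizer)
  have HN: "H \<subseteq> N" using N.subset by simp
  have NA: "normalizer (G\<lparr>carrier := A\<rparr>) H = N \<inter> A"
    unfolding N_def by (rule normalizer_subgroup_eq[OF A.is_subgroup H(2)])
  have sN: "subgroup K (G\<lparr>carrier := N\<rparr>) \<longleftrightarrow> subgroup K G \<and> K \<subseteq> N" for K
    using incl_subgroup[OF N, of K] subgroup_incl[OF _ N, of K] subgroup.subset[of K "G\<lparr>carrier := N\<rparr>"] by auto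
  \<comment> \<open>Right cosets do not involve the carrier, so facts about the quotient of
    \<open>N\<close> can be read with cosets in \<open>G\<close>.\<close>
  have rc: "(#>\<^bsub>G\<lparr>carrier := N\<rparr>\<^esub>) H = (#>) H" by (simp add: fun_eq_iff)
  note QN = N.subgroup_rcosets_image[unfolded rc sN] and UN = N.subgroup_Mod_Union[unfolded rc sN]
  have out: "outer_subgroups G A p H = {Q. subgroup Q (G\<lparr>carrier := N\<rparr> Mod H) \<and> card Q = p
      \<and> \<not> Q \<subseteq> (#>) H ` (N \<inter> A)}"
    by (simp add: outer_subgroups_def normalizer_quot_def quot_subgroup_eq NA flip: N_def)
  show ?thesis
  proof (intro equalityI subsetI)
    fix Q assume "Q \<in> outer_subgroups G A p H"
    then have Q: "subgroup Q (G\<lparr>carrier := N\<rparr> Mod H)" "card Q = p" "\<not> Q \<subseteq> (#>) H ` (N \<inter> A)"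
      by (auto simp: out)
    note K = UN[OF Q(1)]
    let ?K = "\<Union>Q"
    have KN: "subgroup ?K G" "?K \<subseteq> N" using K(1) by simp_all
    have KA: "\<not> ?K \<subseteq> A"
    proof
      assume "?K \<subseteq> A"
      with KN(2) have "(#>) H ` ?K \<subseteq> (#>) H ` (N \<inter> A)" by (intro image_mono Int_greatest)
      then show False using Q(3) by (simp only: K(3))
    qed
    have sKA: "subgroup (?K \<inter> A) G" using KN(1) A.is_subgroup by (rule subgroups_Inter_pair)
    \<comment> \<open>As \<open>Q\<close> has prime order, its subgroup
      \<open>(?K \<inter> A)/H\<close> is trivial or all of \<open>Q\<close>. The latter would put
      \<open>Q\<close> inside \<open>N_A(H)/H\<close>, so \<open>?K \<inter> A\<close> reduces to
      \<open>H\<close>.\<close>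
    have "(#>) H ` (?K \<inter> A) = {\<one>\<^bsub>G\<lparr>carrier := N\<rparr> Mod H\<^esub>} \<or> (#>) H ` (?K \<inter> A) = Q"
    proof (rule group.subgroup_of_prime_order[OF N.factorgroup_is_group Q(1)])
      show "subgroup ((#>) H ` (?K \<inter> A)) (G\<lparr>carrier := N\<rparr> Mod H)"
        by (rule QN) (use sKA KN(2) in auto)
      show "(#>) H ` (?K \<inter> A) \<subseteq> Q"
        by (subst K(3)[symmetric]) (rule image_mono[OF Int_lower1])
    qed (use Q(2) p in simp)
    moreover have "(#>) H ` (?K \<inter> A) \<noteq> Q"
    proof -
      have "(#>) H ` (?K \<inter> A) \<subseteq> (#>) H ` (N \<inter> A)" using KN(2) by (intro image_mono Int_mono) auto
      then show ?thesis using Q(3) by metis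
    qed
    ultimately have one: "(#>) H ` (?K \<inter> A) = {H}" by (metis one_FactGroup)
    have "?K \<inter> A \<subseteq> H"
    proof
      fix x assume x: "x \<in> ?K \<inter> A"
      then have "H #> x = H" using one by (metis imageI singletonD)
      then show "x \<in> H" by (rule coset_join1[OF _ subgroup.mem_carrier[OF sKA x] H(1)])
    qed
    then have "?K \<inter> A = H" using K(2) H(2) by (intro equalityI Int_greatest)
    then show "Q \<in> (`) ((#>) H) ` {K. subgroup K G \<and> \<not> K \<subseteq> A \<and> K \<inter> A = H}"
      using KN(1) KA K(3) by (intro image_eqI[of _ _ ?K]) simp_all
  next
    fix Q assume "Q \<in> (`) ((#>) H) ` {K. subgroup K G \<and> \<not> K \<subseteq> A \<and> K \<inter> A = H}"
    then obtain K where K: "subgroup K G" "\<not> K \<subseteq> A" "K \<inter> A = H" and Q: "Q = (#>) H ` K" by blast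
    have "K \<subseteq> N" unfolding N_def using subset_normalizer_Int[OF K(1)] K(3) by simp
    moreover have "card Q = p" using card_rcosets_image_Int[OF K(1,2)] K(3) Q by simp
    moreover have "\<not> Q \<subseteq> (#>) H ` (N \<inter> A)"
    proof
      assume "Q \<subseteq> (#>) H ` (N \<inter> A)"
      then have "\<Union>((#>) H ` K) \<subseteq> \<Union>((#>) H ` (N \<inter> A))" unfolding Q by (rule Union_mono)
      moreover have "\<Union>((#>) H ` K) = K" by (rule Union_rcosets_image[OF H(1) K(1)]) (use K(3) in auto)
      moreover have "\<Union>((#>) H ` (N \<inter> A)) = N \<inter> A"
        by (rule Union_rcosets_image[OF H(1) subgroups_Inter_pair[OF N A.is_subgroup]])
           (use H(2) HN in simp)
      ultimately have "K \<subseteq> A" by simp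
      with K(2) show False ..
    qed
    ultimately show "Q \<in> outer_subgroups G A p H" using QN[of K] K(1) Q unfolding out by blast
  qed
qed

text \<open>The map \<open>K \<mapsto> K \<inter> A\<close> is equivariant, so the stabiliser of
  \<open>H\<close> acts on the fibre over \<open>H\<close>.\<close>

lemma conj_by_mem_Int_eq:
  assumes H: "subgroup H G" and g: "g \<in> normalizer G H"
    and K: "subgroup K G" "\<not> K \<subseteq> A" "K \<inter> A = H"
  shows "subgroup (conj_by G g K) G" "\<not> conj_by G g K \<subseteq> A" "conj_by G g K \<inter> A = H"
proof -
  have HG: "H \<subseteq> carrier G" using H by (rule subgroup.subset)
  have g': "g \<in> carrier G" "conj_by G g H = H" using g by (simp_all add: mem_normalizer_iff[OF HG])
  show s: "subgroup (conj_by G g K) G" using g'(1) K(1) by (rule subgroup_conj_by)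
  have KG: "K \<subseteq> carrier G" using K(1) by (rule subgroup.subset)
  have "conj_by G g (K \<inter> A) = conj_by G g K \<inter> A"
    unfolding conj_by_Int[OF g'(1) KG A.subset] conj_by_normal[OF A g'(1)] ..
  then show i: "conj_by G g K \<inter> A = H" using g'(2) K(3) by simp
  show "\<not> conj_by G g K \<subseteq> A"
  proof
    \<comment> \<open>Then the conjugate of \<open>K\<close> equals \<open>H\<close>, which is also
      the conjugate of \<open>H\<close>. Undoing the conjugation gives \<open>K = H\<close>,
      contrary to \<open>K\<close> not lying in \<open>A\<close>.\<close>
    assume "conj_by G g K \<subseteq> A"
    then have "conj_by G g K = conj_by G g H" using i g'(2) by (simp only: Int_absorb2)
    then have "K = H" using conj_by_inv[OF g'(1) KG] conj_by_inv[OF g'(1) HG] by metis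
    then show False using K(2,3) by blast
  qed
qed

text \<open>The hypothesis on \<open>T\<close> is pulled back along \<open>K \<mapsto> K/H\<close>,
  which matches both the representatives and the classes.\<close>

lemma is_transversal_generate:
  assumes H: "subgroup H G" "H \<subseteq> A" and T: "transversal_generators G A p H T"
  shows "is_transversal ((\<lambda>t. generate G (insert t H)) ` T)
    (conj_classes G (normalizer G H) {K. subgroup K G \<and> \<not> K \<subseteq> A \<and> K \<inter> A = H})"
    (is "is_transversal ?D (conj_classes G ?N ?R)")
proof (rule is_transversal_image_inj[where f = "(`) ((#>) H)"])
  have N: "subgroup ?N G" by (rule normalizer_imp_subgroup[OF subgroup.subset[OF H(1)]])
  interpret N: normal H "G\<lparr>carrier := ?N\<rparr>" using H(1) by (rule subgroup_in_normalizer)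
  have rc: "(#>\<^bsub>G\<lparr>carrier := ?N\<rparr>\<^esub>) H = (#>) H" by (simp add: fun_eq_iff)
  have TN: "T \<subseteq> ?N" using T by (simp add: transversal_generators_def)
  have RN: "K \<subseteq> ?N" if "K \<in> ?R" for K
    using subset_normalizer_Int[of K] that by simp
  have "conj_classes (normalizer_quot G H) (carrier (normalizer_quot G H)) (outer_subgroups G A p H)
      = (`) ((`) ((#>) H)) ` conj_classes G ?N ?R"
    using N.conj_classes_Mod[of ?R, unfolded rc] RN
    by (simp add: normalizer_quot_def outer_subgroups_eq[OF H] conj_classes_subgroup[OF N])
  moreover have "(\<lambda>t. quot_subgroup G (H <#> generate G {t}) H) ` T = (`) ((#>) H) ` ?D"
    unfolding image_image quot_subgroup_eq
    by (rule image_cong[OF refl]) (use TN generate_insert_normalizer[OF H(1)] in \<open>simp add: subset_iff\<close>)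
  ultimately show "is_transversal ((`) ((#>) H) ` ?D) ((`) ((`) ((#>) H)) ` conj_classes G ?N ?R)"
    using T by (simp add: transversal_generators_def)
  \<comment> \<open>Representatives and class members are all subgroups containing \<open>H\<close>,
    exactly where \<open>Union\<close> undoes \<open>K \<mapsto> K/H\<close>.\<close>
  have D: "subgroup K G \<and> H \<subseteq> K" if KD: "K \<in> ?D" for K
  proof -
    obtain t where t: "t \<in> T" and K: "K = generate G (insert t H)" using KD by blast
    have "insert t H \<subseteq> carrier G"
      using subsetD[OF subgroup.subset[OF N] subsetD[OF TN t]] subgroup.subset[OF H(1)] by simp
    then show ?thesis unfolding K using generate_is_subgroup by (simp add: subset_iff generate.incl)
  qed
  have R: "subgroup K G \<and> H \<subseteq> K" if K: "K \<in> \<Union>(conj_classes G ?N ?R)" for K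
  proof -
    obtain L g where L: "subgroup L G" "\<not> L \<subseteq> A" "L \<inter> A = H" "g \<in> ?N" "K = conj_by G g L"
      using K unfolding conj_classes_image by fast
    show ?thesis using conj_by_mem_Int_eq(1,3)[OF H(1) L(4) L(1-3)] unfolding L(5) by simp blast
  qed
  show "inj_on ((`) ((#>) H)) (?D \<union> \<Union>(conj_classes G ?N ?R))"
  proof (rule inj_on_inverseI[where g = Union])
    fix K assume "K \<in> ?D \<union> \<Union>(conj_classes G ?N ?R)"
    then have "subgroup K G \<and> H \<subseteq> K" using D R by (rule UnE)
    then show "\<Union>((#>) H ` K) = K" using Union_rcosets_image[OF H(1)] by simp
  qed
qed

section \<open>Gluing the transversals over the different \<open>H\<close>\<close>

lemma conj_by_factor_prime_index:
  assumes "subgroup R G" "\<not> R \<subseteq> A" "g \<in> carrier G"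
  obtains a where "a \<in> A" "conj_by G g R = conj_by G a R"
proof -
  \<comment> \<open>The factor \<open>r\<close> fixes \<open>R\<close> under conjugation, so only
    the factor in \<open>A\<close> matters.\<close>
  obtain a r where ar: "a \<in> A" "r \<in> R" "g = a \<otimes> r"
    using assms by (rule factor_prime_index)
  have "conj_by G g R = conj_by G a (conj_by G r R)"
    unfolding ar(3)
    by (rule conj_by_mult[symmetric, OF A.mem_carrier[OF ar(1)] subgroup.mem_carrier[OF assms(1) ar(2)]
          subgroup.subset[OF assms(1)]])
  then have "conj_by G g R = conj_by G a R" by (simp add: conj_by_subgroup[OF assms(1) ar(2)])
  then show thesis using ar(1) that by blast
qed

text \<open>Representatives of the base, with representatives of each fibre under its stabiliser,
  give representatives of the total space. The base is taken modulo \<open>A\<close> and the total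
  space modulo \<open>G\<close>; \<open>conj_by_factor_prime_index\<close> reconciles the
  two.\<close>

lemma is_transversal_by_intersection:
  fixes \<H> :: "'a set set" and \<D> :: "'a set \<Rightarrow> 'a set set"
  assumes \<H>: "is_transversal \<H> (conj_classes G A {H. subgroup H G \<and> H \<subseteq> A})"
    and \<D>: "\<And>H. subgroup H G \<Longrightarrow> H \<subseteq> A \<Longrightarrow> is_transversal (\<D> H)
      (conj_classes G (normalizer G H) {K. subgroup K G \<and> \<not> K \<subseteq> A \<and> K \<inter> A = H})"
  shows "disjoint_family_on \<D> \<H>"
    and "is_transversal (\<Union>H\<in>\<H>. \<D> H) (conj_classes G (carrier G) {R. subgroup R G \<and> \<not> R \<subseteq> A})"
proof -
  let ?R = "\<lambda>H. {K. subgroup K G \<and> \<not> K \<subseteq> A \<and> K \<inter> A = H}"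
  note \<H>_iff = \<H>[unfolded is_transversal_conj_classes_iff]
  have \<D>_mem: "\<exists>K\<in>?R H. \<exists>g\<in>normalizer G H. R = conj_by G g K"
    if "subgroup H G" "H \<subseteq> A" "R \<in> \<D> H" for H R
    using \<D>[OF that(1,2)] that(3) unfolding is_transversal_conj_classes_iff by (elim conjE) (rule bspec)
  have \<D>_ex1: "\<exists>!R. R \<in> \<D> H \<and> (\<exists>g\<in>normalizer G H. R = conj_by G g K)"
    if "subgroup H G" "H \<subseteq> A" "K \<in> ?R H" for H K
    using \<D>[OF that(1,2)] that(3) unfolding is_transversal_conj_classes_iff by (elim conjE) (rule bspec)
  have sub: "subgroup H G \<and> H \<subseteq> A" if H: "H \<in> \<H>" for H
  proof -
    obtain L a where L: "subgroup L G" "L \<subseteq> A" "a \<in> A" "H = conj_by G a L"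
      using bspec[OF conjunct1[OF \<H>_iff] H] by (elim bexE CollectE conjE)
    have "conj_by G a L \<subseteq> conj_by G a A" unfolding conj_by_image using L(2) by (rule image_mono)
    then show ?thesis
      using subgroup_conj_by[OF A.mem_carrier L(1)] L(3) conj_by_subgroup[OF A.is_subgroup L(3)]
      unfolding L(4) by simp
  qed
  \<comment> \<open>A member of \<open>\<D> H\<close> determines \<open>H\<close> as its
    intersection with \<open>A\<close>, which gives disjointness.\<close>
  have mem: "subgroup R G \<and> \<not> R \<subseteq> A \<and> R \<inter> A = H" if HR: "H \<in> \<H>" "R \<in> \<D> H" for H R
  proof -
    have H: "subgroup H G" "H \<subseteq> A" using sub[OF HR(1)] by simp_all
    obtain K g where K: "subgroup K G" "\<not> K \<subseteq> A" "K \<inter> A = H" "g \<in> normalizer G H" "R = conj_by G g K"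
      using \<D>_mem[OF H HR(2)] by (elim bexE CollectE conjE)
    show ?thesis using conj_by_mem_Int_eq[OF H(1) K(4) K(1-3)] unfolding K(5) by (intro conjI)
  qed
  show "disjoint_family_on \<D> \<H>"
  proof (unfold disjoint_family_on_def, intro ballI impI equals0I)
    fix H H' R assume "H \<in> \<H>" "H' \<in> \<H>" "H \<noteq> H'" "R \<in> \<D> H \<inter> \<D> H'"
    then show False using mem[of H R] mem[of H' R] by simp
  qed
  have conj_Int: "conj_by G g (R \<inter> A) = conj_by G g R \<inter> A" if "subgroup R G" "g \<in> carrier G" for g R
    unfolding conj_by_Int[OF that(2) subgroup.subset[OF that(1)] A.subset] conj_by_normal[OF A that(2)] ..
  \<comment> \<open>First an \<open>a \<in> A\<close> moves \<open>R0 \<inter> A\<close> to its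
    representative \<open>H\<close>; then an element of the normaliser of \<open>H\<close> moves the
    conjugate of \<open>R0\<close> into \<open>\<D> H\<close>.\<close>
  have ex: "\<exists>R. R \<in> (\<Union>H\<in>\<H>. \<D> H) \<and> (\<exists>g\<in>carrier G. R = conj_by G g R0)"
    if R0: "subgroup R0 G" "\<not> R0 \<subseteq> A" for R0
  proof -
    have "R0 \<inter> A \<in> {H. subgroup H G \<and> H \<subseteq> A}"
      using subgroups_Inter_pair[OF R0(1) A.is_subgroup] by simp
    from bspec[OF conjunct2[OF \<H>_iff] this]
    obtain H a where H: "H \<in> \<H>" "a \<in> A" "H = conj_by G a (R0 \<inter> A)"
      by (elim ex1E conjE bexE)
    have a: "a \<in> carrier G" using H(2) by (rule A.mem_carrier)
    let ?R1 = "conj_by G a R0"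
    have R1: "subgroup ?R1 G" using a R0(1) by (rule subgroup_conj_by)
    have R1A: "?R1 \<inter> A = H" unfolding H(3) conj_Int[OF R0(1) a] ..
    have "\<not> ?R1 \<subseteq> A"
    proof
      assume "?R1 \<subseteq> A"
      then have "conj_by G (inv a) ?R1 \<subseteq> conj_by G (inv a) A" unfolding conj_by_image by (rule image_mono)
      then show False
        unfolding conj_by_inv[OF a subgroup.subset[OF R0(1)]] conj_by_normal[OF A inv_closed[OF a]]
        using R0(2) by (rule notE[rotated])
    qed
    then have "?R1 \<in> ?R H" using R1 R1A by simp
    with sub[OF H(1)] obtain R g where R: "R \<in> \<D> H" "g \<in> normalizer G H" "R = conj_by G g ?R1"
      using \<D>_ex1[of H ?R1] by (elim conjE) (metis (lifting))
    have "H \<subseteq> carrier G" using sub[OF H(1)] by (intro subgroup.subset) simp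
    then have g: "g \<in> carrier G" using R(2) by (simp add: mem_normalizer_iff)
    have "R = conj_by G (g \<otimes> a) R0"
      unfolding R(3) by (rule conj_by_mult[OF g a subgroup.subset[OF R0(1)]])
    then show ?thesis using H(1) R(1) m_closed[OF g a] by (intro exI[of _ R] conjI UN_I bexI)
  qed
  \<comment> \<open>The conjugator may be taken as some \<open>a \<in> A\<close>. It carries
    \<open>H\<close> to \<open>H'\<close>, so \<open>H' = H\<close> by the choice of
    \<open>\<H>\<close>. Hence \<open>a\<close> normalises \<open>H\<close>, and uniqueness within
    \<open>\<D> H\<close> applies.\<close>
  have uniq: "R' = R"
    if R: "H \<in> \<H>" "R \<in> \<D> H" and R': "H' \<in> \<H>" "R' \<in> \<D> H'"
      and g: "g \<in> carrier G" "R' = conj_by G g R" for H H' R R' g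
  proof -
    have m: "subgroup R G" "\<not> R \<subseteq> A" "R \<inter> A = H" "R' \<inter> A = H'" using mem[OF R] mem[OF R'] by simp_all
    have H: "subgroup H G" "H \<subseteq> A" using sub[OF R(1)] by simp_all
    have HG: "H \<subseteq> carrier G" using H(1) by (rule subgroup.subset)
    obtain a where a: "a \<in> A" "R' = conj_by G a R"
      using conj_by_factor_prime_index[OF m(1,2) g(1)] g(2) by metis
    have aG: "a \<in> carrier G" using a(1) by (rule A.mem_carrier)
    have H': "H' = conj_by G a H" using conj_Int[OF m(1) aG] a(2) m(3,4) by simp
    have "\<exists>!x. x \<in> \<H> \<and> (\<exists>g\<in>A. x = conj_by G g H)"
      using H by (intro bspec[OF conjunct2[OF \<H>_iff]]) simp
    moreover have "\<exists>g\<in>A. H = conj_by G g H"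
      using conj_by_one[OF HG] by (intro bexI[of _ \<one>] A.one_closed) simp
    moreover have "\<exists>g\<in>A. H' = conj_by G g H" using a(1) H' by (rule bexI[rotated])
    ultimately have "H' = H" using R(1) R'(1) by (metis (lifting))
    then have aN: "a \<in> normalizer G H" using H' aG by (simp add: mem_normalizer_iff[OF HG])
    have "\<exists>!x. x \<in> \<D> H \<and> (\<exists>g\<in>normalizer G H. x = conj_by G g R)"
      using m by (intro \<D>_ex1[OF H]) simp
    moreover have "\<exists>g\<in>normalizer G H. R = conj_by G g R"
      using conj_by_one[OF subgroup.subset[OF m(1)]]
      by (intro bexI[of _ \<one>] subgroup.one_closed[OF normalizer_imp_subgroup[OF HG]]) simp
    moreover have "\<exists>g\<in>normalizer G H. R' = conj_by G g R" using aN a(2) by (rule bexI[rotated])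
    ultimately show ?thesis using R(2) R'(2) \<open>H' = H\<close> by (metis (lifting))
  qed
  show "is_transversal (\<Union>H\<in>\<H>. \<D> H) (conj_classes G (carrier G) {R. subgroup R G \<and> \<not> R \<subseteq> A})"
    unfolding is_transversal_conj_classes_iff
  proof (intro conjI ballI)
    fix R assume "R \<in> (\<Union>H\<in>\<H>. \<D> H)"
    then have R: "subgroup R G \<and> \<not> R \<subseteq> A" using mem by (elim UN_E) simp
    then have "R = conj_by G \<one> R" using conj_by_one[OF subgroup.subset] by simp
    then show "\<exists>L\<in>{R. subgroup R G \<and> \<not> R \<subseteq> A}. \<exists>g\<in>carrier G. R = conj_by G g L"
      using R by (intro bexI[of _ R] bexI[of _ \<one>] one_closed) simp_all
  next
    fix R0 assume "R0 \<in> {R. subgroup R G \<and> \<not> R \<subseteq> A}"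
    then have R0: "subgroup R0 G" "\<not> R0 \<subseteq> A" by simp_all
    show "\<exists>!R. R \<in> (\<Union>H\<in>\<H>. \<D> H) \<and> (\<exists>g\<in>carrier G. R = conj_by G g R0)"
    proof (rule ex_ex1I[OF ex[OF R0]], elim conjE UN_E bexE)
      fix R R' H H' g g'
      assume R: "H \<in> \<H>" "R \<in> \<D> H" and R': "H' \<in> \<H>" "R' \<in> \<D> H'"
        and g: "g \<in> carrier G" "R = conj_by G g R0" and g': "g' \<in> carrier G" "R' = conj_by G g' R0"
      have R0G: "R0 \<subseteq> carrier G" using R0(1) by (rule subgroup.subset)
      \<comment> \<open>Passing through \<open>R0\<close>, the element
        \<open>g \<otimes> inv g'\<close> conjugates \<open>R'\<close> to \<open>R\<close>, as
        \<open>uniq\<close> requires.\<close>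
      have "R' \<subseteq> carrier G" using mem[OF R'] by (intro subgroup.subset) simp
      then have "conj_by G (g \<otimes> inv g') R' = conj_by G g (conj_by G (inv g') R')"
        by (rule conj_by_mult[OF g(1) inv_closed[OF g'(1)], symmetric])
      also have "\<dots> = R" unfolding g'(2) conj_by_inv[OF g'(1) R0G] g(2) ..
      finally show "R = R'" using uniq[OF R' R m_closed[OF g(1) inv_closed[OF g'(1)]]] by simp
    qed
  qed
qed

end

end

text \<open>The coproduct is expressed as disjointness of the family over \<open>\<H>\<close>
  together with its union. Each member is a set of subgroups, so different \<open>t\<close>
  generating the same subgroup with \<open>H\<close> count once.\<close>

theorem proposition3p4:
  fixes S :: "('a, 'b) monoid_scheme" and A :: "'a set" and p :: nat
    and \<B> \<R> \<H> :: "'a set set" and T :: "'a set \<Rightarrow> 'a set"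
  assumes "group S" and "finite (carrier S)"
    and "Factorial_Ring.prime p"
    and "A \<lhd> S" and "card (rcosets\<^bsub>S\<^esub> A) = p"
    and \<B>_eq: "\<B> = {H. subgroup H S \<and> H \<subseteq> A}"
    and \<R>_eq: "\<R> = {R. subgroup R S \<and> \<not> R \<subseteq> A}"
    and T: "\<And>H. H \<in> \<B> \<Longrightarrow> transversal_generators S A p H (T H)"
    and \<H>: "is_transversal \<H> (conj_classes S A \<B>)"
  shows "disjoint_family_on (\<lambda>H. {generate S (insert t H) | t. t \<in> T H}) \<H> \<and>
    is_transversal (\<Union>H\<in>\<H>. {generate S (insert t H) | t. t \<in> T H})
      (conj_classes S (carrier S) \<R>)"
proof -
  interpret S: group S by fact
  note index = \<open>A \<lhd> S\<close> \<open>Factorial_Ring.prime p\<close> \<open>card (rcosets\<^bsub>S\<^esub> A) = p\<close>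
  have D: "is_transversal {generate S (insert t H) | t. t \<in> T H}
      (conj_classes S (normalizer S H) {K. subgroup K S \<and> \<not> K \<subseteq> A \<and> K \<inter> A = H})"
    if "subgroup H S" "H \<subseteq> A" for H
    using S.is_transversal_generate[OF index that T] that by (simp add: \<B>_eq Setcompr_eq_image)
  show ?thesis
    using S.is_transversal_by_intersection[OF index \<H>[unfolded \<B>_eq] D] unfolding \<R>_eq by (intro conjI)
qed

end
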